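(* Let $R$ be a $\Bbbk$-algebra and let $\mathcal{D}_1$ and $\mathcal{D}_2$ be two independent $\operatorname{Aut}(R)$-submodules of $\operatorname{Der}(R)$. For any $d_1\in\mathcal{D}_1$ and $d_2\in\mathcal{D}_2$, $$\operatorname{Aut}_{d_1+d_2}(R)=\operatorname{Aut}_{d_1}(R)\cap\operatorname{Aut}_{d_2}(R).$$
   Context: $\Bbbk$ is an algebraically closed field of characteristic zero. $\operatorname{Aut}(R)$ and $\operatorname{Der}(R)$ denote the $\Bbbk$-algebra automorphisms and the $\Bbbk$-derivations of $R$. $\operatorname{Aut}(R)$ acts on $\operatorname{Der}(R)$ by $\rho\cdot\delta=\rho\delta\rho^{-1}$. An $\operatorname{Aut}(R)$-submodule is a $\Bbbk$-subspace of $\operatorname{Der}(R)$ stable under this action; two submodules are independent if their intersection is $0$. For $\delta\in\operatorname{Der}(R)$, $\operatorname{Aut}_\delta(R)=\{\rho\in\operatorname{Aut}(R)\mid\rho\delta=\delta\rho\}$. *)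

theory Defs
  imports
    "HOL-Computational_Algebra.Polynomial"
    "HOL-Library.Function_Algebras"
begin

text \<open>
  Associative unital algebras over a field, not assumed commutative. The sort
  \<open>{ring, monoid_mult}\<close> rather than \<open>ring_1\<close> also admits the zero algebra.
\<close>

locale k_algebra = vector_space scale
  for scale :: "'k::field \<Rightarrow> 'r::{ring,monoid_mult} \<Rightarrow> 'r" +
  assumes scale_mult_left: "scale c x * y = scale c (x * y)"
    and scale_mult_right: "x * scale c y = scale c (x * y)"

definition Aut :: "('k::field \<Rightarrow> 'r::{ring,monoid_mult} \<Rightarrow> 'r) \<Rightarrow> ('r \<Rightarrow> 'r) set" where
  "Aut scale = {\<rho>. bij \<rho> \<and> Vector_Spaces.linear scale scale \<rho> \<and>
     (\<forall>x y. \<rho> (x * y) = \<rho> x * \<rho> y) \<and> \<rho> 1 = 1}"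

definition Der :: "('k::field \<Rightarrow> 'r::{ring,monoid_mult} \<Rightarrow> 'r) \<Rightarrow> ('r \<Rightarrow> 'r) set" where
  "Der scale = {\<delta>. Vector_Spaces.linear scale scale \<delta> \<and>
     (\<forall>x y. \<delta> (x * y) = \<delta> x * y + x * \<delta> y)}"

definition aut_act :: "('r \<Rightarrow> 'r) \<Rightarrow> ('r \<Rightarrow> 'r) \<Rightarrow> ('r \<Rightarrow> 'r)" where
  "aut_act \<rho> \<delta> = \<rho> \<circ> \<delta> \<circ> inv \<rho>"

text \<open>
  Addition and zero of maps \<open>'r \<Rightarrow> 'r\<close> are the pointwise ones of
  \<^theory>\<open>HOL-Library.Function_Algebras\<close>; the matching scalar multiplication is:
\<close>

definition fun_scale :: "('k \<Rightarrow> 'r \<Rightarrow> 'r) \<Rightarrow> 'k \<Rightarrow> ('r \<Rightarrow> 'r) \<Rightarrow> ('r \<Rightarrow> 'r)" where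
  "fun_scale scale c f = (\<lambda>x. scale c (f x))"

lemma (in vector_space) vector_space_fun_scale: "vector_space (fun_scale scale)"
  by unfold_locales
    (simp_all add: fun_scale_def fun_eq_iff scale_right_distrib scale_left_distrib)

definition aut_submodule ::
    "('k::field \<Rightarrow> 'r::{ring,monoid_mult} \<Rightarrow> 'r) \<Rightarrow> ('r \<Rightarrow> 'r) set \<Rightarrow> bool" where
  "aut_submodule scale D \<longleftrightarrow> D \<subseteq> Der scale \<and> module.subspace (fun_scale scale) D \<and>
     (\<forall>\<rho>\<in>Aut scale. \<forall>\<delta>\<in>D. aut_act \<rho> \<delta> \<in> D)"

definition independent_submodules :: "('r::zero \<Rightarrow> 'r) set \<Rightarrow> ('r \<Rightarrow> 'r) set \<Rightarrow> bool" where
  "independent_submodules D\<^sub>1 D\<^sub>2 \<longleftrightarrow> D\<^sub>1 \<inter> D\<^sub>2 = {0}"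

definition Aut_stab ::
    "('k::field \<Rightarrow> 'r::{ring,monoid_mult} \<Rightarrow> 'r) \<Rightarrow> ('r \<Rightarrow> 'r) \<Rightarrow> ('r \<Rightarrow> 'r) set" where
  "Aut_stab scale \<delta> = {\<rho> \<in> Aut scale. \<rho> \<circ> \<delta> = \<delta> \<circ> \<rho>}"

end

theory Submission
  imports Defs
begin

text \<open>
  An automorphism commutes with \<open>\<delta>\<close> iff it fixes \<open>\<delta>\<close> under the conjugation action. The action is
  additive and preserves both submodules, and a sum \<open>d\<^sub>1 + d\<^sub>2\<close> determines its components because
  the submodules are independent; so fixing the sum means fixing each component.
\<close>

text \<open>Composing on the right with \<open>inv \<rho>\<close> or with \<open>\<rho>\<close>
  passes between the two equations. Surjectivity of \<open>\<rho>\<close> cancels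
  \<open>\<rho> \<circ> inv \<rho>\<close>, injectivity cancels
  \<open>inv \<rho> \<circ> \<rho>\<close>.\<close>

lemma commute_iff_aut_act_eq:
  assumes "bij \<rho>"
  shows "\<rho> \<circ> \<delta> = \<delta> \<circ> \<rho> \<longleftrightarrow> aut_act \<rho> \<delta> = \<delta>"
proof
  assume "\<rho> \<circ> \<delta> = \<delta> \<circ> \<rho>"
  then have "aut_act \<rho> \<delta> = \<delta> \<circ> (\<rho> \<circ> inv \<rho>)"
    by (simp add: aut_act_def comp_assoc)
  also have "\<rho> \<circ> inv \<rho> = id"
    using assms by (simp add: bij_is_surj flip: surj_iff)
  finally show "aut_act \<rho> \<delta> = \<delta>" by simp
next
  assume "aut_act \<rho> \<delta> = \<delta>"
  then have "\<delta> \<circ> \<rho> = \<rho> \<circ> \<delta> \<circ> (inv \<rho> \<circ> \<rho>)"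
    by (metis aut_act_def comp_assoc)
  also have "inv \<rho> \<circ> \<rho> = id"
    using assms by (simp add: bij_is_inj)
  finally show "\<rho> \<circ> \<delta> = \<delta> \<circ> \<rho>" by (simp add: comp_def)
qed

lemma Aut_stab_eq: "Aut_stab scale \<delta> = {\<rho> \<in> Aut scale. aut_act \<rho> \<delta> = \<delta>}"
  by (auto simp: Aut_stab_def Aut_def commute_iff_aut_act_eq)

text \<open>Sums of maps are pointwise, so precomposing with \<open>inv \<rho>\<close> respects them
  automatically; the outer \<open>\<rho>\<close> does so by linearity.\<close>

lemma aut_act_add:
  assumes "\<rho> \<in> Aut scale"
  shows "aut_act \<rho> (\<delta> + \<epsilon>) = aut_act \<rho> \<delta> + aut_act \<rho> \<epsilon>"
proof -
  interpret Vector_Spaces.linear scale scale \<rho>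
    using assms by (simp add: Aut_def)
  show ?thesis
    by (simp add: aut_act_def fun_eq_iff add)
qed

text \<open>The element \<open>a - a' = b' - b\<close> lies in both subspaces, hence vanishes.
  Stating this for an abstract module lets it be used on a space of maps.\<close>

lemma (in module) independent_sum_unique:
  assumes "subspace S" "subspace T" "S \<inter> T = {0}"
    and "a \<in> S" "a' \<in> S" "b \<in> T" "b' \<in> T" and sum: "a + b = a' + b'"
  shows "a = a' \<and> b = b'"
proof -
  have eq: "a - a' = b' - b"
    using sum by (simp add: algebra_simps)
  have "a - a' \<in> S"
    using assms by (simp add: subspace_diff)
  moreover have "a - a' \<in> T"
    unfolding eq using assms by (simp add: subspace_diff)
  ultimately have "a - a' = 0"
    using assms(3) by blast
  then show ?thesis
    using eq by simp
qed

theorem lemma19: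
  fixes scale :: "'k::{alg_closed_field,field_char_0} \<Rightarrow> 'r::{ring,monoid_mult} \<Rightarrow> 'r"
    and D\<^sub>1 D\<^sub>2 :: "('r \<Rightarrow> 'r) set"
    and d\<^sub>1 d\<^sub>2 :: "'r \<Rightarrow> 'r"
  assumes "k_algebra scale"
    and "aut_submodule scale D\<^sub>1"
    and "aut_submodule scale D\<^sub>2"
    and "independent_submodules D\<^sub>1 D\<^sub>2"
    and "d\<^sub>1 \<in> D\<^sub>1"
    and "d\<^sub>2 \<in> D\<^sub>2"
  shows "Aut_stab scale (d\<^sub>1 + d\<^sub>2) = Aut_stab scale d\<^sub>1 \<inter> Aut_stab scale d\<^sub>2"
proof -
  interpret k_algebra scale by fact
  \<comment> \<open>The submodules are subspaces of the space of all maps on the algebra, so the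
    uniqueness of components is needed there.\<close>
  interpret F: vector_space "fun_scale scale"
    by (rule vector_space_fun_scale)
  have "aut_act \<rho> (d\<^sub>1 + d\<^sub>2) = d\<^sub>1 + d\<^sub>2 \<longleftrightarrow> aut_act \<rho> d\<^sub>1 = d\<^sub>1 \<and> aut_act \<rho> d\<^sub>2 = d\<^sub>2"
    if \<rho>: "\<rho> \<in> Aut scale" for \<rho>
  proof -
    have "aut_act \<rho> d\<^sub>1 \<in> D\<^sub>1" "aut_act \<rho> d\<^sub>2 \<in> D\<^sub>2"
      using assms \<rho> by (auto simp: aut_submodule_def)
    moreover have "F.subspace D\<^sub>1" "F.subspace D\<^sub>2" "D\<^sub>1 \<inter> D\<^sub>2 = {0}"
      using assms by (simp_all add: aut_submodule_def independent_submodules_def)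
    \<comment> \<open>By additivity, fixing the sum means that
      \<open>aut_act \<rho> d\<^sub>1 + aut_act \<rho> d\<^sub>2\<close> and
      \<open>d\<^sub>1 + d\<^sub>2\<close> are two decompositions of one map. Uniqueness gives the
      forward direction; the converse is additivity alone.\<close>
    ultimately show ?thesis
      using F.independent_sum_unique[of D\<^sub>1 D\<^sub>2 "aut_act \<rho> d\<^sub>1" d\<^sub>1 "aut_act \<rho> d\<^sub>2" d\<^sub>2] assms(5,6)
      by (auto simp: aut_act_add[OF \<rho>])
  qed
  then show ?thesis
    by (auto simp: Aut_stab_eq)
qed

end
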